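(* Let $k\ge 1$ be a fixed integer and let $\alpha\ge 1$ be fixed. Let $(\gamma_n)_{n\in N_0}$ be a sequence, each term of which is a ratio of odd positive integers, such that $$\gamma^+=\sup_{n\in N_0}\gamma_n\le 1 .$$ Let $f:\mathbb{R}\to\mathbb{R}$ be a locally Lipschitz function. Let $r:N_0\to\mathbb{R}\setminus\{0\}$ and $a,q:N_0\to\mathbb{R}$ satisfy $$\sum_{n=0}^{\infty}\left[\left|\frac{1}{r_n}\right|\sum_{i=n}^{\infty}|a_i|\right]^{1/\gamma^+}<+\infty,\qquad \sum_{n=0}^{\infty}\left[\left|\frac{1}{r_n}\right|\sum_{i=n}^{\infty}|q_i|\right]^{1/\gamma^+}<+\infty ,$$ and $$\sum_{i=0}^{\infty}|a_i|<+\infty,\qquad \sum_{i=0}^{\infty}|q_i|<+\infty .$$ Let $p:N_0\to\mathbb{R}\setminus\{0\}$ satisfy $$-1<\liminf_{n\to\infty}p_n\le\limsup_{n\to\infty}p_n<1 .$$ Then the equation $$\Delta\left(r_n\left(\Delta(x_n+p_nx_{n-k})\right)^{\gamma_n}\right)+q_nx_n^{\alpha}+a_nf(x_{n+1})=0$$ has a bounded solution $x$.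
   Context: $N_0=\{0,1,2,\dots\}$ and $N_k=\{k,k+1,\dots\}$. $\Delta$ is the forward difference operator, $\Delta y_n=y_{n+1}-y_n$. A solution of the equation is a real sequence $x=(x_n)_{n\in N_0}$ which satisfies the equation for every $n\in N_k$. For $\gamma$ a ratio of odd positive integers and $t\in\mathbb{R}$, $t^{\gamma}$ is the real odd power $\operatorname{sgn}(t)|t|^{\gamma}$. The exponent $\alpha\ge1$ is understood to be such that $t\mapsto t^{\alpha}$ is a real-valued power function on all of $\mathbb{R}$ (i.e. $\alpha$ is a rational number with odd denominator in lowest terms, for instance a positive integer or a ratio of odd positive integers). *)

theory Defs
  imports "HOL-Analysis.Analysis"
begin

definition fdiff :: "(nat \<Rightarrow> real) \<Rightarrow> nat \<Rightarrow> real"  (\<open>\<Delta>\<close>)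
  where "\<Delta> y n = y (n + 1) - y n"

definition ratio_of_odds :: "real \<Rightarrow> bool"
  where "ratio_of_odds g \<longleftrightarrow>
    (\<exists>u v :: nat. odd u \<and> odd v \<and> g = real u / real v)"

definition odd_power :: "real \<Rightarrow> real \<Rightarrow> real"
  where "odd_power t g = sgn t * \<bar>t\<bar> powr g"

text \<open>Powers of arbitrary reals with a nonnegative rational exponent whose denominator \<open>d\<close> in
  lowest terms is odd: \<open>t\<close> to the power \<open>m/d\<close> is \<open>root d t ^ m\<close>, where the library's \<open>root d\<close> is the
  real odd root, also for negative arguments.  \<open>quotient_of\<close> returns the pair in lowest terms with
  positive denominator.\<close>

definition odd_denominator :: "rat \<Rightarrow> bool"
  where "odd_denominator \<alpha> \<longleftrightarrow> odd (snd (quotient_of \<alpha>))"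

definition rat_power :: "real \<Rightarrow> rat \<Rightarrow> real"
  where "rat_power t \<alpha> = root (nat (snd (quotient_of \<alpha>))) t ^ nat (fst (quotient_of \<alpha>))"

lemma rat_power_nonneg_base:
  assumes "t \<ge> 0" "\<alpha> > 0"
  shows "rat_power t \<alpha> = t powr (of_rat \<alpha>)"
proof -
  obtain m d where md: "quotient_of \<alpha> = (m, d)" by (cases "quotient_of \<alpha>")
  have d: "d > 0" using quotient_of_denom_pos[OF md] .
  have \<alpha>: "\<alpha> = of_int m / of_int d" using quotient_of_div[OF md] .
  have m: "m > 0" using assms(2) d by (subst (asm) \<alpha>) (simp add: zero_less_divide_iff)
  have r: "(of_rat \<alpha> :: real) = of_int m / of_int d" by (subst \<alpha>) (simp add: of_rat_divide)
  show ?thesis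
  proof (cases "t = 0")
    case True
    then show ?thesis using m d by (simp add: rat_power_def md)
  next
    case False
    then have "t > 0" using assms by simp
    have "rat_power t \<alpha> = root (nat d) t powr real (nat m)"
      using \<open>t > 0\<close> d by (simp add: rat_power_def md powr_realpow)
    also have "\<dots> = (t powr (1 / real (nat d))) powr real (nat m)"
      using \<open>t > 0\<close> d by (simp only: root_powr_inverse zero_less_nat_eq)
    also have "\<dots> = t powr (of_rat \<alpha>)"
      using m d by (simp add: powr_powr r)
    finally show ?thesis .
  qed
qed

end

theory Submission
  imports Defs
begin

text \<open>A solution of the equation for \<open>n \<ge> N\<close> is a fixed point of
  \<open>T x n = - p n * x (n - k) - (\<Sum>j\<ge>n. (Y x j / r j) powr (1 / \<gamma> j))\<close>, where
  \<open>Y x j = (\<Sum>i\<ge>j. q i * x i powr \<alpha> + a i * f (x (i + 1)))\<close> with \<open>odd_power\<close> in the first and \<open>rat_power\<close> in the second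
  place of \<open>powr\<close>.  On the unit ball of
  bounded sequences the delay term is Lipschitz with a constant below 1, and the summability
  hypotheses make the Lipschitz constant of the series arbitrarily small for large \<open>N\<close>: the exponents
  \<open>b = 1 / \<gamma> j\<close> need not be bounded, but \<open>b * u powr b \<le> c * u powr c\<close> for \<open>1 \<le> c \<le> b\<close> once \<open>u\<close> is small.
  So \<open>T\<close> is a contraction.  Since \<open>p n\<close> never vanishes, the solution is then continued
  backwards one index at a time, changing only finitely many terms.\<close>

section \<open>Estimates for real, odd and rational powers\<close>

text \<open>Mean value theorem; the derivative at the intermediate point is at most the one at
  \<open>t\<close> because \<open>b - 1 \<ge> 0\<close>. Differentiability is used only at interior
  points, which are positive even when \<open>s = 0\<close>.\<close>

lemma powr_diff_le:
  fixes b s t :: real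
  assumes "1 \<le> b" "0 \<le> s" "s \<le> t"
  shows "t powr b - s powr b \<le> b * t powr (b - 1) * (t - s)"
proof (cases "s = t")
  case False
  then have "s < t" using assms by simp
  moreover have "continuous_on {s..t} (\<lambda>x. x powr b)"
    using assms by (intro continuous_on_powr') auto
  moreover have "((\<lambda>x. x powr b) has_derivative (\<lambda>h. b * x powr (b - 1) * h)) (at x)" if "s < x" for x
    using has_real_derivative_powr[of x b] that assms
    by (simp add: has_field_derivative_def)
  ultimately obtain z where z: "s < z" "z < t" "t powr b - s powr b = b * z powr (b - 1) * (t - s)"
    using mvt[of s t "\<lambda>x. x powr b" "\<lambda>x h. b * x powr (b - 1) * h"] by metis
  then show ?thesis
    using assms by (auto intro!: mult_mono mult_nonneg_nonneg powr_mono2)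
qed simp

lemma odd_power_minus: "odd_power (- t) b = - odd_power t b"
  by (simp add: odd_power_def)

lemma odd_power_nonneg: "0 \<le> t \<Longrightarrow> odd_power t b = t powr b"
  by (auto simp: odd_power_def sgn_if)

lemma abs_odd_power: "\<bar>odd_power t b\<bar> = \<bar>t\<bar> powr b"
  by (auto simp: odd_power_def abs_mult sgn_if)

lemma odd_power_inverse:
  assumes "g \<noteq> 0"
  shows "odd_power (odd_power t (1 / g)) g = t"
  using assms by (cases "t = 0") (auto simp: odd_power_def abs_mult sgn_mult powr_powr sgn_mult_abs)

text \<open>For arguments of equal sign, oddness reduces the bound to \<open>powr_diff_le\<close>.
  For opposite signs the difference is a sum of two powers, each estimated by
  \<open>x powr b \<le> u powr (b - 1) * x\<close>. The factor \<open>u powr (b - 1)\<close> is kept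
  in the constant because it later makes the constant small.\<close>

lemma odd_power_lipschitz:
  fixes b s t u :: real
  assumes b: "1 \<le> b" and "\<bar>s\<bar> \<le> u" "\<bar>t\<bar> \<le> u"
  shows "\<bar>odd_power s b - odd_power t b\<bar> \<le> b * u powr (b - 1) * \<bar>s - t\<bar>"
proof -
  have same: "\<bar>odd_power s b - odd_power t b\<bar> \<le> b * u powr (b - 1) * \<bar>s - t\<bar>"
    if "0 \<le> s" "s \<le> t" "t \<le> u" for s t
  proof -
    have "b * t powr (b - 1) * (t - s) \<le> b * u powr (b - 1) * (t - s)"
      using b that by (intro mult_right_mono mult_left_mono powr_mono2) auto
    moreover have "s powr b \<le> t powr b" using b that by (intro powr_mono2) auto
    ultimately show ?thesis
      using powr_diff_le[OF b that(1,2)] that by (simp add: odd_power_nonneg)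
  qed
  have opposite: "\<bar>odd_power s b - odd_power t b\<bar> \<le> b * u powr (b - 1) * \<bar>s - t\<bar>"
    if "s \<le> 0" "0 \<le> t" "- s \<le> u" "t \<le> u" for s t
  proof -
    have *: "x powr b \<le> b * u powr (b - 1) * x" if "0 \<le> x" "x \<le> u" for x
    proof -
      have "x powr b \<le> x powr (b - 1) * x"
        using that by (cases "x = 0") (auto simp: powr_diff)
      also have "\<dots> \<le> 1 * u powr (b - 1) * x"
        using that b by (auto intro!: mult_right_mono powr_mono2)
      also have "\<dots> \<le> b * u powr (b - 1) * x"
        using that b by (intro mult_right_mono) auto
      finally show ?thesis .
    qed
    have "\<bar>odd_power s b - odd_power t b\<bar> = (- s) powr b + t powr b"
      using odd_power_nonneg[of "- s" b] that powr_ge_zero[of "- s" b] powr_ge_zero[of t b]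
      by (simp add: odd_power_nonneg odd_power_minus del: powr_ge_zero)
    also have "\<dots> \<le> b * u powr (b - 1) * (t - s)"
      using *[of "- s"] *[of t] that by (simp add: algebra_simps)
    finally show ?thesis using that by simp
  qed
  show ?thesis
    using assms same[of s t] same[of t s] same[of "- s" "- t"] same[of "- t" "- s"]
      opposite[of s t] opposite[of t s]
    by (simp add: odd_power_minus abs_le_iff abs_minus_commute)
      (smt (verit))
qed

text \<open>\<open>root d\<close> is an odd function, so the sign of \<open>t\<close> factors out,
  and the parity of the numerator decides whether the power is even or odd.\<close>

lemma rat_power_eq:
  assumes "\<alpha> > 0"
  shows "rat_power t \<alpha> = sgn t ^ nat (fst (quotient_of \<alpha>)) * \<bar>t\<bar> powr of_rat \<alpha>"
proof -
  have m: "0 < fst (quotient_of \<alpha>)"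
    using assms by (metis prod.exhaust_sel quotient_of_div of_int_0_less_iff
        quotient_of_denom_pos' zero_less_divide_iff order_less_asym)
  have "root d t = sgn t * root d \<bar>t\<bar>" for d
    by (simp add: real_root_abs sgn_if real_root_minus)
  then have "rat_power t \<alpha> = sgn t ^ nat (fst (quotient_of \<alpha>)) * rat_power \<bar>t\<bar> \<alpha>"
    unfolding rat_power_def by (metis power_mult_distrib)
  then show ?thesis using rat_power_nonneg_base[of "\<bar>t\<bar>" \<alpha>] assms by simp
qed

lemma abs_rat_power_le:
  assumes "\<alpha> > 0" "\<bar>t\<bar> \<le> 1"
  shows "\<bar>rat_power t \<alpha>\<bar> \<le> 1"
proof -
  have "\<bar>rat_power t \<alpha>\<bar> \<le> 1 * \<bar>\<bar>t\<bar> powr of_rat \<alpha>\<bar>"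
    unfolding rat_power_eq[OF assms(1)] abs_mult power_abs
    by (intro mult_right_mono power_le_one) (auto simp: abs_sgn_eq)
  also have "\<dots> \<le> 1" using assms by (simp add: powr_le1)
  finally show ?thesis .
qed

text \<open>According to the parity of the numerator the power is \<open>odd_power\<close> or its
  absolute value, and taking absolute values does not increase distances.\<close>

lemma rat_power_lipschitz:
  assumes \<alpha>: "\<alpha> \<ge> 1" and st: "\<bar>s\<bar> \<le> 1" "\<bar>t\<bar> \<le> 1"
  shows "\<bar>rat_power s \<alpha> - rat_power t \<alpha>\<bar> \<le> of_rat \<alpha> * \<bar>s - t\<bar>"
proof -
  define m where "m = nat (fst (quotient_of \<alpha>))"
  have pos: "\<alpha> > 0" using \<alpha> by simp
  have one: "1 \<le> (of_rat \<alpha> :: real)" using \<alpha> by simp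
  have *: "\<bar>odd_power s (of_rat \<alpha>) - odd_power t (of_rat \<alpha>)\<bar> \<le> of_rat \<alpha> * \<bar>s - t\<bar>"
    using odd_power_lipschitz[OF one st] by simp
  show ?thesis
  proof (cases "even m")
    case True
    have "rat_power x \<alpha> = \<bar>odd_power x (of_rat \<alpha>)\<bar>" for x
      using True rat_power_eq[OF pos, of x]
      by (auto simp: abs_odd_power m_def sgn_if)
    then show ?thesis using * by (smt (verit))
  next
    case False
    then have "rat_power x \<alpha> = odd_power x (of_rat \<alpha>)" for x
      using rat_power_eq[OF pos, of x]
      by (auto simp: odd_power_def m_def sgn_if)
    then show ?thesis using * by simp
  qed
qed

text \<open>Serves to trade exponents \<open>1 / \<gamma> j\<close> that vary with the index for the
  single exponent of the summability hypothesis. For \<open>u > 0\<close>, with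
  \<open>v = u powr c\<close> and \<open>s = b / c\<close>, the claim amounts to
  \<open>s * v powr (s - 1) \<le> 1\<close>, which follows from \<open>s \<le> exp (s - 1)\<close>
  and \<open>v \<le> exp (- 1)\<close>.\<close>

lemma mult_powr_le:
  fixes b c u :: real
  assumes c: "1 \<le> c" "c \<le> b" and u: "0 \<le> u" "u powr c \<le> exp (- 1)"
  shows "b * u powr b \<le> c * u powr c"
proof (cases "u = 0")
  case False
  then have u0: "u > 0" using u by simp
  define s where "s = b / c"
  have s: "s \<ge> 1" and b: "b = c * s" using c by (auto simp: s_def)
  have "s \<le> exp (s - 1)" using exp_ge_add_one_self[of "s - 1"] by simp
  moreover have "(u powr c) powr (s - 1) \<le> exp (- 1) powr (s - 1)"
    using u s by (intro powr_mono2) auto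
  ultimately have "s * (u powr c) powr (s - 1) \<le> exp (s - 1) * exp (- (s - 1))"
    using s by (intro mult_mono) (auto simp: powr_def)
  also have "\<dots> = 1" by (simp flip: exp_add)
  finally have "c * u powr c * (s * (u powr c) powr (s - 1)) \<le> c * u powr c * 1"
    using c by (intro mult_left_mono) auto
  moreover have "u powr b = u powr c * (u powr c) powr (s - 1)"
    using u0 by (simp add: b powr_powr algebra_simps flip: powr_add)
  ultimately show ?thesis by (simp add: b mult_ac)
qed simp

section \<open>Fixed points in the space of bounded sequences\<close>

text \<open>The library makes \<open>'a \<Rightarrow>\<^sub>C 'b\<close> a \<^class>\<open>complete_space\<close> only for a metric domain,
  and the type of natural numbers is not in that class.\<close>

lemma complete_UNIV_bcontfun:
  "complete (UNIV :: ('a::topological_space \<Rightarrow>\<^sub>C 'b::complete_space) set)"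
proof (rule completeI)
  fix f :: "nat \<Rightarrow> 'a \<Rightarrow>\<^sub>C 'b"
  assume "Cauchy f"
  \<comment> \<open>The conjunct \<open>True\<close> is the domain predicate in the instance of
    \<open>uniformly_convergent_eq_cauchy\<close> below.\<close>
  then have "\<exists>N. \<forall>m n x. N \<le> m \<and> N \<le> n \<and> True \<longrightarrow> dist (f m x) (f n x) < e" if "e > 0" for e
    using that unfolding Cauchy_def by (meson dist_fun_lt_imp_dist_val_lt)
  then obtain g where "uniform_limit UNIV f g sequentially"
    using uniformly_convergent_eq_cauchy[of "\<lambda>_. True" "\<lambda>n x. f n x"]
    unfolding uniform_limit_sequentially_iff by auto
  then show "\<exists>l\<in>UNIV. f \<longlonglongrightarrow> l"
    using uniform_limit_bcontfunE by (metis UNIV_I sequentially_bot)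
qed

text \<open>Banach's fixed point theorem on the closed ball of radius \<open>M\<close>: over the
  discrete space of natural numbers, bounded sequences are the same as bounded continuous functions.
  In \<open>contr\<close> any pointwise bound \<open>d\<close> replaces the supremum distance, so no
  supremum has to be computed in applications.\<close>

lemma sequence_contraction:
  fixes F :: "(nat \<Rightarrow> real) \<Rightarrow> nat \<Rightarrow> real"
  assumes M: "0 \<le> M" and c: "0 \<le> c" "c < 1"
    and maps: "\<And>x n. (\<And>n. \<bar>x n\<bar> \<le> M) \<Longrightarrow> \<bar>F x n\<bar> \<le> M"
    and contr: "\<And>x y d n. (\<And>n. \<bar>x n\<bar> \<le> M) \<Longrightarrow> (\<And>n. \<bar>y n\<bar> \<le> M) \<Longrightarrow> (\<And>n. \<bar>x n - y n\<bar> \<le> d)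
      \<Longrightarrow> \<bar>F x n - F y n\<bar> \<le> c * d"
  obtains x where "\<And>n. F x n = x n" "\<And>n. \<bar>x n\<bar> \<le> M"
proof -
  define S :: "(nat \<Rightarrow>\<^sub>C real) set" where "S = cball 0 M"
  \<comment> \<open>\<open>Bcontfun\<close> is meaningful only on bounded functions;
    \<open>maps\<close> provides the bound for \<open>x\<close> in \<open>S\<close>, and
    \<open>G\<close> is evaluated only there.\<close>
  define G where "G x = Bcontfun (F (apply_bcontfun x))" for x
  have S: "\<bar>x n\<bar> \<le> M" if "x \<in> S" for x :: "nat \<Rightarrow>\<^sub>C real" and n
    using norm_bounded[of x n] that by (simp add: S_def)
  have G: "apply_bcontfun (G x) = F x" if "x \<in> S" for x :: "nat \<Rightarrow>\<^sub>C real"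
    unfolding G_def using maps[of x] S[OF that]
    by (intro Bcontfun_inverse bcontfun_normI[where b = M]) auto
  have "\<exists>!x\<in>S. G x = x"
  proof (rule Banach_fix[OF _ _ c])
    show "complete S"
      unfolding S_def by (rule complete_closed_subset[OF closed_cball subset_UNIV complete_UNIV_bcontfun])
    show "S \<noteq> {}" using M by (auto simp: S_def)
    show "G ` S \<subseteq> S"
    proof clarify
      fix x assume "x \<in> S"
      then show "G x \<in> S"
        using norm_bound[of "G x" M] maps[of x] S[of x] G by (simp add: S_def)
    qed
    show "dist (G x) (G y) \<le> c * dist x y" if "x \<in> S" "y \<in> S" for x y
    proof (rule dist_bound)
      fix n
      show "dist (G x n) (G y n) \<le> c * dist x y"
        using contr[of x y "dist x y"] S[OF that(1)] S[OF that(2)] dist_bounded[of x _ y]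
        by (simp add: G that dist_real_def)
    qed
  qed
  then obtain x where "x \<in> S" "G x = x" by blast
  then show ?thesis using that[of x] G[of x] S[of x] by simp
qed

lemma suminf_tail_Suc:
  fixes h :: "nat \<Rightarrow> real"
  assumes "summable h"
  shows "(\<Sum>i. h (n + i)) = h n + (\<Sum>i. h (Suc n + i))"
  using suminf_split_head[of "\<lambda>i. h (n + i)"] summable_ignore_initial_segment[OF assms, of n]
  by (simp add: add.commute)

section \<open>The equation and its backward continuation\<close>

text \<open>\<open>F\<close> abstracts the two nonlinear terms together. The continuation works for
  every \<open>F\<close>, the fixed point argument for those with summable size and Lipschitz
  bounds.\<close>

definition solves_at :: "nat \<Rightarrow> (nat \<Rightarrow> real) \<Rightarrow> (nat \<Rightarrow> real) \<Rightarrow> (nat \<Rightarrow> real) \<Rightarrow>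
    (nat \<Rightarrow> real \<Rightarrow> real \<Rightarrow> real) \<Rightarrow> (nat \<Rightarrow> real) \<Rightarrow> nat \<Rightarrow> bool"
  where "solves_at k r p \<gamma> F x n \<longleftrightarrow>
    \<Delta> (\<lambda>m. r m * odd_power (\<Delta> (\<lambda>j. x j + p j * x (j - k)) m) (\<gamma> m)) n
      + F n (x n) (x (n + 1)) = 0"

lemma solves_at_iff:
  "solves_at k r p \<gamma> F x n \<longleftrightarrow>
    r (n + 1) * odd_power ((x (n + 2) + p (n + 2) * x (n + 2 - k))
        - (x (n + 1) + p (n + 1) * x (n + 1 - k))) (\<gamma> (n + 1))
    - r n * odd_power ((x (n + 1) + p (n + 1) * x (n + 1 - k)) - (x n + p n * x (n - k))) (\<gamma> n)
    + F n (x n) (x (n + 1)) = 0"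
  by (simp add: solves_at_def fdiff_def)

text \<open>The value \<open>x (n - k)\<close> enters the equation at \<open>n\<close> only through \<open>p n * x (n - k)\<close>, and the
  equations at later indices not at all; so it can be chosen to make the equation hold at \<open>n\<close>.\<close>

lemma solution_extend_step:
  assumes k: "k \<ge> 1" "k \<le> n" and \<gamma>: "\<gamma> n \<noteq> 0" and r: "r n \<noteq> 0" and p: "p n \<noteq> 0"
    and sol: "\<And>m. m \<ge> Suc n \<Longrightarrow> solves_at k r p \<gamma> F x m"
  obtains v where "\<And>m. m \<ge> n \<Longrightarrow> solves_at k r p \<gamma> F (x(n - k := v)) m"
proof -
  \<comment> \<open>Solving the equation at \<open>n\<close> for the odd power of the difference at
    \<open>n\<close> gives \<open>t\<close>, which involves \<open>x\<close> only at indices above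
    \<open>n - k\<close>. Inverting the odd power and dividing by \<open>p n\<close> then gives
    \<open>v\<close>.\<close>
  define t where "t = (r (n + 1) * odd_power ((x (n + 2) + p (n + 2) * x (n + 2 - k))
        - (x (n + 1) + p (n + 1) * x (n + 1 - k))) (\<gamma> (n + 1)) + F n (x n) (x (n + 1))) / r n"
  define v where "v = ((x (n + 1) + p (n + 1) * x (n + 1 - k)) - odd_power t (1 / \<gamma> n) - x n) / p n"
  define y where "y = x(n - k := v)"
  have later: "y j = x j" if "j > n - k" for j
    using that by (simp add: y_def)
  \<comment> \<open>\<open>k \<le> n\<close> excludes truncated subtraction, so
    \<open>n + 1 - k\<close> and \<open>n + 2 - k\<close> differ from \<open>n - k\<close>;
    \<open>k \<ge> 1\<close> separates \<open>n\<close> itself from \<open>n - k\<close>.\<close>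
  have yx: "y n = x n" "y (n + 1) = x (n + 1)" "y (n + 2) = x (n + 2)"
    "y (n + 1 - k) = x (n + 1 - k)" "y (n + 2 - k) = x (n + 2 - k)" "y (n - k) = v"
    using k by (auto simp: y_def)
  have "(x (n + 1) + p (n + 1) * x (n + 1 - k)) - (x n + p n * v) = odd_power t (1 / \<gamma> n)"
    using p by (simp add: v_def)
  then have "solves_at k r p \<gamma> F y n"
    unfolding solves_at_iff yx using r by (simp add: odd_power_inverse[OF \<gamma>] t_def)
  moreover have "solves_at k r p \<gamma> F y m" if "m \<ge> Suc n" for m
  proof -
    have "y m = x m" "y (m + 1) = x (m + 1)" "y (m + 2) = x (m + 2)"
      "y (m - k) = x (m - k)" "y (m + 1 - k) = x (m + 1 - k)" "y (m + 2 - k) = x (m + 2 - k)"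
      using that k by (auto intro!: later)
    then show ?thesis using sol[OF that] unfolding solves_at_iff by simp
  qed
  ultimately show ?thesis
    using that[of v] by (metis le_eq_less_or_eq Suc_leI y_def)
qed

text \<open>Induction on the threshold: each step lowers it by one and alters a single value, which
  preserves boundedness. Once the threshold is at most \<open>k\<close>, the sequence at hand
  already qualifies.\<close>

lemma bounded_solution_extend:
  assumes k: "k \<ge> 1" and \<gamma>: "\<And>n. \<gamma> n \<noteq> 0" and r: "\<And>n. r n \<noteq> 0" and p: "\<And>n. p n \<noteq> 0"
    and "bounded (range x)" "\<And>n. n \<ge> N \<Longrightarrow> solves_at k r p \<gamma> F x n"
  shows "\<exists>x. bounded (range x) \<and> (\<forall>n\<ge>k. solves_at k r p \<gamma> F x n)"
  using assms(5,6)
proof (induction N arbitrary: x)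
  case 0
  then show ?case by blast
next
  case (Suc N)
  show ?case
  proof (cases "k \<le> N")
    case True
    obtain v where "\<And>m. m \<ge> N \<Longrightarrow> solves_at k r p \<gamma> F (x(N - k := v)) m"
      using solution_extend_step[OF k True \<gamma> r p Suc.prems(2)] by blast
    moreover have "range (x(N - k := v)) \<subseteq> insert v (range x)" by auto
    then have "bounded (range (x(N - k := v)))"
      using Suc.prems(1) bounded_subset bounded_insert by metis
    ultimately show ?thesis by (rule Suc.IH[rotated])
  next
    case False
    then show ?thesis using Suc.prems by (intro exI[of _ x]) auto
  qed
qed

section \<open>Existence of a solution for large indices\<close>

text \<open>Reals \<open>l\<close> and \<open>u\<close> chosen inside the two gaps eventually
  enclose \<open>p n\<close>. The resulting \<open>\<rho>\<close> becomes the Lipschitz constant of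
  the delay term.\<close>

lemma abs_less_eventually_of_liminf_limsup:
  fixes p :: "nat \<Rightarrow> real"
  assumes "- 1 < liminf (\<lambda>n. ereal (p n))" "limsup (\<lambda>n. ereal (p n)) < 1"
  obtains \<rho> where "0 \<le> \<rho>" "\<rho> < 1" "eventually (\<lambda>n. \<bar>p n\<bar> \<le> \<rho>) sequentially"
proof -
  obtain l where l: "- 1 < ereal l" "ereal l < liminf (\<lambda>n. ereal (p n))"
    using ereal_dense2[OF assms(1)] by blast
  obtain u where u: "limsup (\<lambda>n. ereal (p n)) < ereal u" "ereal u < 1"
    using ereal_dense2[OF assms(2)] by blast
  have "eventually (\<lambda>n. p n > l \<and> p n < u) sequentially"
    using less_LiminfD[OF l(2)] Limsup_lessD[OF u(1)] by eventually_elim simp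
  then have "eventually (\<lambda>n. \<bar>p n\<bar> \<le> max 0 (max (- l) u)) sequentially"
    by eventually_elim auto
  moreover have "max 0 (max (- l) u) < 1" using l(1) u(2) by (simp add: one_ereal_def)
  ultimately show ?thesis using that by (metis max.cobounded1)
qed

text \<open>The weight \<open>w n\<close> controls both the size and the Lipschitz constant of
  \<open>F n\<close> on the unit square, so one summability condition covers both coefficient
  sequences; \<open>g\<close> will be the supremum of the exponents.\<close>

lemma bounded_solution_eventually:
  fixes F :: "nat \<Rightarrow> real \<Rightarrow> real \<Rightarrow> real" and r p \<gamma> w :: "nat \<Rightarrow> real"
  assumes \<gamma>: "\<And>n. 0 < \<gamma> n" "\<And>n. \<gamma> n \<le> g" "g \<le> 1"
    and r: "\<And>n. r n \<noteq> 0"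
    and w: "summable w"
    and F: "\<And>n s t. \<bar>s\<bar> \<le> 1 \<Longrightarrow> \<bar>t\<bar> \<le> 1 \<Longrightarrow> \<bar>F n s t\<bar> \<le> w n"
    and F_lip: "\<And>n s t s' t' d. \<lbrakk>\<bar>s\<bar> \<le> 1; \<bar>t\<bar> \<le> 1; \<bar>s'\<bar> \<le> 1; \<bar>t'\<bar> \<le> 1; \<bar>s - s'\<bar> \<le> d; \<bar>t - t'\<bar> \<le> d\<rbrakk>
      \<Longrightarrow> \<bar>F n s t - F n s' t'\<bar> \<le> w n * d"
    and U: "summable (\<lambda>n. (\<bar>1 / r n\<bar> * (\<Sum>i. w (n + i))) powr (1 / g))"
    and p: "- 1 < liminf (\<lambda>n. ereal (p n))" "limsup (\<lambda>n. ereal (p n)) < 1"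
  obtains x N where "\<And>n. \<bar>x n\<bar> \<le> 1" "\<And>n. n \<ge> N \<Longrightarrow> solves_at k r p \<gamma> F x n"
proof -
  define c where "c = 1 / g"
  define W where "W n = (\<Sum>i. w (n + i))" for n
  define u where "u n = \<bar>1 / r n\<bar> * W n" for n
  \<comment> \<open>\<open>V\<close> is the summable majorant of both the terms \<open>h x n\<close>
    and their Lipschitz constants, for \<open>n\<close> beyond \<open>N\<close>; the exponent
    \<open>c\<close> is a lower bound of all \<open>1 / \<gamma> n\<close>.\<close>
  define V where "V n = c * u n powr c" for n
  have g0: "0 < g" using \<gamma>(1)[of 0] \<gamma>(2)[of 0] by simp
  have c: "1 \<le> c" "c \<le> 1 / \<gamma> n" for n
    using g0 \<gamma>(1)[of n] \<gamma>(2)[of n] \<gamma>(3) by (auto simp: c_def intro!: frac_le)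
  have w0: "0 \<le> w n" for n using F[of 0 0 n] by simp
  have tail: "summable (\<lambda>i. h (n + i))" if "summable h" for h :: "nat \<Rightarrow> real" and n
    using summable_ignore_initial_segment[OF that, of n] by (simp add: add.commute)
  have W0: "0 \<le> W n" for n unfolding W_def by (rule suminf_nonneg[OF tail[OF w] w0])
  have u0: "0 \<le> u n" for n using W0 by (simp add: u_def)
  have U': "summable (\<lambda>n. u n powr c)" using U by (simp add: u_def W_def c_def)
  then have V: "summable V" unfolding V_def by (rule summable_mult)
  obtain \<rho> where \<rho>: "0 \<le> \<rho>" "\<rho> < 1" "eventually (\<lambda>n. \<bar>p n\<bar> \<le> \<rho>) sequentially"
    using abs_less_eventually_of_liminf_limsup[OF p] .
  have "eventually (\<lambda>n. u n powr c < exp (- 1)) sequentially"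
    using summable_LIMSEQ_zero[OF U'] by (rule order_tendstoD) simp
  \<comment> \<open>The series receives half of the gap \<open>1 - \<rho>\<close> left by the delay
    term, so the total constant \<open>\<rho> + (1 - \<rho>) / 2\<close> stays below 1.\<close>
  moreover obtain N0 where "\<forall>n\<ge>N0. norm (\<Sum>i. V (i + n)) < (1 - \<rho>) / 2"
    using suminf_exist_split[OF _ V, of "(1 - \<rho>) / 2"] \<rho> by auto
  then have "eventually (\<lambda>n. (\<Sum>i. V (n + i)) \<le> (1 - \<rho>) / 2) sequentially"
    unfolding eventually_sequentially by (intro exI[of _ N0]) (auto simp: add.commute abs_less_iff less_imp_le)
  ultimately have "eventually (\<lambda>n. \<bar>p n\<bar> \<le> \<rho> \<and> u n powr c < exp (- 1)
      \<and> (\<Sum>i. V (n + i)) \<le> (1 - \<rho>) / 2) sequentially"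
    using \<rho>(3) by eventually_elim auto
  then obtain N where N: "\<And>n. n \<ge> N \<Longrightarrow> \<bar>p n\<bar> \<le> \<rho>"
    "\<And>n. n \<ge> N \<Longrightarrow> u n powr c \<le> exp (- 1)"
    "\<And>n. n \<ge> N \<Longrightarrow> (\<Sum>i. V (n + i)) \<le> (1 - \<rho>) / 2"
    unfolding eventually_sequentially by (metis less_imp_le)
  have uV: "1 / \<gamma> n * u n powr (1 / \<gamma> n) \<le> V n" if "n \<ge> N" for n
    unfolding V_def by (rule mult_powr_le[OF c u0 N(2)[OF that]])

  define Y where "Y x j = (\<Sum>i. F (j + i) (x (j + i)) (x (j + i + 1)))" for x j
  define h where "h x j = odd_power (Y x j / r j) (1 / \<gamma> j)" for x j
  \<comment> \<open>Below \<open>N\<close> the value 0 is a default that trivially respects the ball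
    and the contraction; a delayed index \<open>n - k\<close> may fall there and then reads 0 at the
    fixed point.\<close>
  define T where "T x n = (if n < N then 0 else - p n * x (n - k) - (\<Sum>i. h x (n + i)))" for x n

  have F_sum: "summable (\<lambda>i. F i (x i) (x (i + 1)))" if "\<And>n. \<bar>x n\<bar> \<le> 1" for x
    by (rule summable_comparison_test'[OF w]) (simp add: F that)
  have Y: "\<bar>Y x j / r j\<bar> \<le> u j" if "\<And>n. \<bar>x n\<bar> \<le> 1" for x j
  proof -
    have "\<bar>Y x j\<bar> \<le> W j"
      unfolding Y_def W_def real_norm_def[symmetric]
      by (rule norm_suminf_le[OF _ tail[OF w]]) (simp add: F that)
    then show ?thesis using r[of j] by (simp add: u_def abs_divide divide_right_mono)
  qed
  have Y_diff: "\<bar>Y x j / r j - Y y j / r j\<bar> \<le> u j * d"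
    if "\<And>n. \<bar>x n\<bar> \<le> 1" "\<And>n. \<bar>y n\<bar> \<le> 1" "\<And>n. \<bar>x n - y n\<bar> \<le> d" for x y j d
  proof -
    have "Y x j - Y y j = (\<Sum>i. F (j + i) (x (j + i)) (x (j + i + 1)) - F (j + i) (y (j + i)) (y (j + i + 1)))"
      unfolding Y_def using tail[OF F_sum[of x], of j] tail[OF F_sum[of y], of j] that
      by (intro suminf_diff) auto
    also have "\<bar>\<dots>\<bar> \<le> (\<Sum>i. w (j + i) * d)"
      unfolding real_norm_def[symmetric]
      by (rule norm_suminf_le[OF _ summable_mult2[OF tail[OF w]]]) (simp add: F_lip that)
    also have "\<dots> = W j * d"
      unfolding W_def by (rule suminf_mult2[OF tail[OF w], symmetric])
    finally show ?thesis
      using r[of j] by (simp add: u_def abs_divide divide_right_mono flip: diff_divide_distrib)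
  qed
  have h: "\<bar>h x j\<bar> \<le> V j" if "\<And>n. \<bar>x n\<bar> \<le> 1" "j \<ge> N" for x j
  proof -
    have "\<bar>h x j\<bar> \<le> u j powr (1 / \<gamma> j)"
      unfolding h_def abs_odd_power using Y[OF that(1)] \<gamma>(1)[of j] by (intro powr_mono2) auto
    also have "\<dots> \<le> 1 / \<gamma> j * u j powr (1 / \<gamma> j)"
      using mult_right_mono[OF order_trans[OF c] powr_ge_zero] by simp
    also note uV[OF that(2)]
    finally show ?thesis .
  qed
  have h_diff: "\<bar>h x j - h y j\<bar> \<le> V j * d"
    if "\<And>n. \<bar>x n\<bar> \<le> 1" "\<And>n. \<bar>y n\<bar> \<le> 1" "\<And>n. \<bar>x n - y n\<bar> \<le> d" "j \<ge> N" for x y j d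
  proof -
    have b: "1 \<le> 1 / \<gamma> j" using c order_trans by blast
    have d: "0 \<le> d" using that(3)[of 0] by linarith
    have "\<bar>h x j - h y j\<bar> \<le> 1 / \<gamma> j * u j powr (1 / \<gamma> j - 1) * \<bar>Y x j / r j - Y y j / r j\<bar>"
      unfolding h_def by (rule odd_power_lipschitz[OF b Y Y]) (fact that)+
    also have "\<dots> \<le> 1 / \<gamma> j * u j powr (1 / \<gamma> j - 1) * (u j * d)"
      using \<gamma>(1)[of j] by (intro mult_left_mono Y_diff that mult_nonneg_nonneg) auto
    \<comment> \<open>The factor \<open>u j\<close> coming from \<open>Y_diff\<close> raises the
      exponent back to \<open>1 / \<gamma> j\<close>, the form that \<open>uV\<close>
      bounds.\<close>
    also have "\<dots> = 1 / \<gamma> j * u j powr (1 / \<gamma> j) * d"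
      using u0[of j] by (cases "u j = 0") (auto simp: powr_diff)
    also have "\<dots> \<le> V j * d" by (rule mult_right_mono[OF uV[OF that(4)] d])
    finally show ?thesis .
  qed
  have h_sum: "summable (h x)" if "\<And>n. \<bar>x n\<bar> \<le> 1" for x
    by (rule summable_comparison_test'[OF V, of N]) (simp add: h that)

  obtain x where x: "\<And>n. T x n = x n" "\<And>n. \<bar>x n\<bar> \<le> 1"
  proof (rule sequence_contraction[of 1 "\<rho> + (1 - \<rho>) / 2" T])
    show "0 \<le> \<rho> + (1 - \<rho>) / 2" "\<rho> + (1 - \<rho>) / 2 < 1" using \<rho> by (auto simp: field_simps)
    show "\<bar>T x n\<bar> \<le> 1" if x: "\<And>n. \<bar>x n\<bar> \<le> 1" for x n
    proof (cases "n < N")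
      case False
      have "\<bar>p n * x (n - k)\<bar> \<le> \<rho> * 1"
        unfolding abs_mult using False by (intro mult_mono N x \<rho>) auto
      moreover have "\<bar>\<Sum>i. h x (n + i)\<bar> \<le> (\<Sum>i. V (n + i))"
        unfolding real_norm_def[symmetric]
        by (rule norm_suminf_le[OF _ tail[OF V]]) (use False in \<open>simp add: h x\<close>)
      ultimately show ?thesis
        using N(3)[of n] False \<rho> by (simp add: T_def field_simps)
    qed (simp add: T_def)
    show "\<bar>T x n - T y n\<bar> \<le> (\<rho> + (1 - \<rho>) / 2) * d"
      if x: "\<And>n. \<bar>x n\<bar> \<le> 1" and y: "\<And>n. \<bar>y n\<bar> \<le> 1" and d: "\<And>n. \<bar>x n - y n\<bar> \<le> d" for x y d n
    proof -
      have d0: "0 \<le> d" using d[of 0] by linarith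
      show ?thesis
      proof (cases "n < N")
        case True
        then show ?thesis using d0 \<rho> by (simp add: T_def)
      next
        case False
        have "\<bar>p n * (x (n - k) - y (n - k))\<bar> \<le> \<rho> * d"
          unfolding abs_mult using False by (intro mult_mono N d \<rho>) auto
        moreover have "\<bar>\<Sum>i. h x (n + i) - h y (n + i)\<bar> \<le> (\<Sum>i. V (n + i) * d)"
          unfolding real_norm_def[symmetric]
          by (rule norm_suminf_le[OF _ summable_mult2[OF tail[OF V]]])
            (use False in \<open>simp add: h_diff x y d\<close>)
        moreover have "(\<Sum>i. V (n + i) * d) = (\<Sum>i. V (n + i)) * d"
          by (rule suminf_mult2[OF tail[OF V], symmetric])
        moreover have "(\<Sum>i. V (n + i)) * d \<le> (1 - \<rho>) / 2 * d"
          using False by (intro mult_right_mono N d0) auto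
        moreover have "(\<Sum>i. h x (n + i) - h y (n + i)) = (\<Sum>i. h x (n + i)) - (\<Sum>i. h y (n + i))"
          by (rule suminf_diff[symmetric]) (intro tail h_sum x y)+
        ultimately have "\<bar>p n * (x (n - k) - y (n - k))\<bar> \<le> \<rho> * d"
          "\<bar>(\<Sum>i. h x (n + i)) - (\<Sum>i. h y (n + i))\<bar> \<le> (1 - \<rho>) / 2 * d" by linarith+
        moreover have "T x n - T y n = - (p n * (x (n - k) - y (n - k)))
            - ((\<Sum>i. h x (n + i)) - (\<Sum>i. h y (n + i)))"
          using False by (simp add: T_def algebra_simps)
        ultimately show ?thesis unfolding distrib_right by linarith
      qed
    qed
  qed (auto intro: that)

  \<comment> \<open>Differencing twice recovers the equation: the tails of \<open>h x\<close> differ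
    by \<open>h x n\<close>, its odd power times \<open>r n\<close> is \<open>Y x n\<close>, and the
    difference of \<open>Y x\<close> at \<open>n\<close> is minus the nonlinear term.\<close>
  have z: "x n + p n * x (n - k) = - (\<Sum>i. h x (n + i))" if "n \<ge> N" for n
    using x(1)[of n] that by (simp add: T_def)
  have \<Delta>z: "(x (n + 1) + p (n + 1) * x (n + 1 - k)) - (x n + p n * x (n - k)) = h x n" if "n \<ge> N" for n
    using z[of n] z[of "n + 1"] that suminf_tail_Suc[OF h_sum[of x, OF x(2)], of n] by simp
  have rh: "r n * odd_power (h x n) (\<gamma> n) = Y x n" for n
    using odd_power_inverse[of "\<gamma> n" "Y x n / r n"] \<gamma>(1)[of n] r[of n] by (simp add: h_def)
  have "solves_at k r p \<gamma> F x n" if "n \<ge> N" for n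
  proof -
    have "Y x n = F n (x n) (x (n + 1)) + Y x (n + 1)"
      using suminf_tail_Suc[OF F_sum[of x, OF x(2)], of n] by (simp add: Y_def)
    moreover have "(x (n + 2) + p (n + 2) * x (n + 2 - k)) - (x (n + 1) + p (n + 1) * x (n + 1 - k)) = h x (n + 1)"
      using \<Delta>z[of "n + 1"] that by (simp add: numeral_2_eq_2)
    ultimately show ?thesis
      unfolding solves_at_iff \<Delta>z[OF that] by (simp only: rh)
  qed
  with x(2) show ?thesis by (rule that)
qed

section \<open>Bounds for the given nonlinear terms and assembly of the solution\<close>

theorem theorem3p1:
  fixes k :: nat and \<alpha> :: rat and \<gamma> :: "nat \<Rightarrow> real" and f :: "real \<Rightarrow> real"
    and r a q p :: "nat \<Rightarrow> real"
  assumes "k \<ge> 1"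
    and "\<alpha> \<ge> 1" and "odd_denominator \<alpha>"
    and "\<And>n. ratio_of_odds (\<gamma> n)"
    and "bdd_above (range \<gamma>)" and "(SUP n. \<gamma> n) \<le> 1"
    and "local_lipschitz (UNIV :: real set) UNIV (\<lambda>_. f)"
    and "\<And>n. r n \<noteq> 0"
    and "summable (\<lambda>n. (\<bar>1 / r n\<bar> * (\<Sum>i. \<bar>a (n + i)\<bar>)) powr (1 / (SUP n. \<gamma> n)))"
    and "summable (\<lambda>n. (\<bar>1 / r n\<bar> * (\<Sum>i. \<bar>q (n + i)\<bar>)) powr (1 / (SUP n. \<gamma> n)))"
    and "summable (\<lambda>i. \<bar>a i\<bar>)" and "summable (\<lambda>i. \<bar>q i\<bar>)"
    and "\<And>n. p n \<noteq> 0"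
    and "- 1 < liminf (\<lambda>n. ereal (p n))"
    and "liminf (\<lambda>n. ereal (p n)) \<le> limsup (\<lambda>n. ereal (p n))"
    and "limsup (\<lambda>n. ereal (p n)) < 1"
  shows "\<exists>x :: nat \<Rightarrow> real. bounded (range x) \<and>
    (\<forall>n\<ge>k. \<Delta> (\<lambda>m. r m * odd_power (\<Delta> (\<lambda>j. x j + p j * x (j - k)) m) (\<gamma> m)) n
              + q n * rat_power (x n) \<alpha> + a n * f (x (n + 1)) = 0)"
proof -
  define g where "g = (SUP n. \<gamma> n)"
  define F where "F n s t = q n * rat_power s \<alpha> + a n * f t" for n s t
  have \<gamma>: "0 < \<gamma> n" "\<gamma> n \<le> g" for n
    using assms(4)[of n] cSUP_upper[OF UNIV_I assms(5), of n]
    by (auto simp: ratio_of_odds_def g_def odd_pos)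
  have g: "0 < g" "g \<le> 1" using \<gamma>[of 0] assms(6) by (auto simp: g_def)

  \<comment> \<open>\<open>f\<close> is constant in the time parameter, so the one-point time set
    \<open>{0}\<close> suffices; compactness of the interval then yields one Lipschitz
    constant.\<close>
  have "local_lipschitz {0::real} {-1..1} (\<lambda>_. f)"
    by (rule local_lipschitz_subset[OF assms(7)]) auto
  from local_lipschitz_compact_implies_lipschitz[OF this compact_Icc compact_sing continuous_on_const]
  obtain L where L: "L-lipschitz_on {-1..1} f" by blast
  have "compact (f ` {-1..1})"
    by (rule compact_continuous_image[OF lipschitz_on_continuous_on[OF L] compact_Icc])
  then have "bounded (f ` {-1..1})" by (rule compact_imp_bounded)
  then obtain B where "\<forall>y\<in>f ` {-1..1}. norm y \<le> B"
    unfolding bounded_iff by blast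
  then have B: "\<bar>f t\<bar> \<le> B" if "\<bar>t\<bar> \<le> 1" for t
    using that by (auto simp: abs_le_iff)
  \<comment> \<open>One constant for the Lipschitz bounds of the power and of \<open>f\<close> and
    for the size of \<open>f\<close> on the unit interval; being at least 1, it also bounds the
    power itself.\<close>
  define C where "C = Max {of_rat \<alpha>, L, B}"
  have C: "of_rat \<alpha> \<le> C" "L \<le> C" "B \<le> C" by (auto simp: C_def)
  have C1: "1 \<le> C" using C(1) assms(2) by (metis of_rat_1 of_rat_less_eq order_trans)
  define w where "w n = C * (\<bar>q n\<bar> + \<bar>a n\<bar>)" for n

  have F: "\<bar>F n s t\<bar> \<le> w n" if "\<bar>s\<bar> \<le> 1" "\<bar>t\<bar> \<le> 1" for n s t
  proof -
    have "\<bar>rat_power s \<alpha>\<bar> \<le> C" "\<bar>f t\<bar> \<le> C"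
      using abs_rat_power_le[of \<alpha> s] assms(2) B[of t] C C1 that by auto
    then have "\<bar>q n * rat_power s \<alpha>\<bar> + \<bar>a n * f t\<bar> \<le> \<bar>q n\<bar> * C + \<bar>a n\<bar> * C"
      unfolding abs_mult by (intro add_mono mult_left_mono) auto
    then show ?thesis using abs_triangle_ineq[of "q n * rat_power s \<alpha>" "a n * f t"]
      by (simp add: F_def w_def algebra_simps)
  qed
  have F_lip: "\<bar>F n s t - F n s' t'\<bar> \<le> w n * d"
    if "\<bar>s\<bar> \<le> 1" "\<bar>t\<bar> \<le> 1" "\<bar>s'\<bar> \<le> 1" "\<bar>t'\<bar> \<le> 1" and d: "\<bar>s - s'\<bar> \<le> d" "\<bar>t - t'\<bar> \<le> d" for n s t s' t' d
  proof -
    have "\<bar>rat_power s \<alpha> - rat_power s' \<alpha>\<bar> \<le> C * d"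
      using rat_power_lipschitz[OF assms(2) that(1,3)] C(1) C1 d(1)
      by (smt (verit) mult_mono abs_ge_zero)
    moreover have "\<bar>f t - f t'\<bar> \<le> C * d"
      using lipschitz_onD[OF L, of t t'] that C(2) C1
      by (smt (verit) mult_mono abs_ge_zero atLeastAtMost_iff dist_real_def)
    ultimately have "\<bar>q n * (rat_power s \<alpha> - rat_power s' \<alpha>)\<bar> + \<bar>a n * (f t - f t')\<bar>
        \<le> \<bar>q n\<bar> * (C * d) + \<bar>a n\<bar> * (C * d)"
      unfolding abs_mult by (intro add_mono mult_left_mono) auto
    then show ?thesis
      using abs_triangle_ineq[of "q n * (rat_power s \<alpha> - rat_power s' \<alpha>)" "a n * (f t - f t')"]
      by (simp add: F_def w_def algebra_simps)
  qed

  have w: "summable w"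
    unfolding w_def by (intro summable_mult summable_add assms)
  have "summable (\<lambda>n. (\<bar>1 / r n\<bar> * (\<Sum>i. w (n + i))) powr (1 / g))"
  proof -
    define S where "S h n = \<bar>1 / r n\<bar> * (\<Sum>i. \<bar>h (n + i)\<bar>)" for h :: "nat \<Rightarrow> real" and n
    have tail: "summable (\<lambda>i. \<bar>h (n + i)\<bar>)" if "summable (\<lambda>i. \<bar>h i\<bar>)" for h :: "nat \<Rightarrow> real" and n
      using summable_ignore_initial_segment[OF that, of n] by (simp add: add.commute)
    have S0: "0 \<le> S h n" if "summable (\<lambda>i. \<bar>h i\<bar>)" for h n
      unfolding S_def by (intro mult_nonneg_nonneg suminf_nonneg tail that) auto
    note S0 = S0[OF assms(11)] S0[OF assms(12)]
    have "(\<Sum>i. w (n + i)) = C * ((\<Sum>i. \<bar>q (n + i)\<bar>) + (\<Sum>i. \<bar>a (n + i)\<bar>))" for n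
      unfolding w_def
      by (subst suminf_mult) (intro summable_add suminf_add[symmetric] arg_cong2[where f = "(*)"] refl tail assms)+
    then have eq: "\<bar>1 / r n\<bar> * (\<Sum>i. w (n + i)) = C * (S q n + S a n)" for n
      by (simp add: S_def distrib_left mult.left_commute)
    \<comment> \<open>A sum of two nonnegative numbers is at most twice their maximum, and the power
      of the maximum is at most the sum of the two powers; this splits the condition on
      \<open>w\<close> into those on \<open>a\<close> and \<open>q\<close>.\<close>
    have le: "(C * (S q n + S a n)) powr (1 / g) \<le> (2 * C) powr (1 / g) * (S a n powr (1 / g) + S q n powr (1 / g))" for n
    proof -
      define m where "m = max (S a n) (S q n)"
      have m: "0 \<le> m" "S q n + S a n \<le> 2 * m" using S0[of n] by (auto simp: m_def)
      have "(C * (S q n + S a n)) powr (1 / g) \<le> (C * (2 * m)) powr (1 / g)"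
        using S0[of n] m g C1 by (intro powr_mono2 mult_left_mono) auto
      also have "\<dots> = (2 * C) powr (1 / g) * m powr (1 / g)"
        using m C1 by (simp add: powr_mult mult_ac)
      also have "\<dots> \<le> (2 * C) powr (1 / g) * (S a n powr (1 / g) + S q n powr (1 / g))"
        by (intro mult_left_mono) (auto simp: m_def max_def)
      finally show ?thesis .
    qed
    have "summable (\<lambda>n. (2 * C) powr (1 / g) * (S a n powr (1 / g) + S q n powr (1 / g)))"
      unfolding S_def g_def by (intro summable_mult summable_add assms)
    then show ?thesis
      unfolding eq by (rule summable_comparison_test') (simp add: le)
  qed
  from bounded_solution_eventually[of \<gamma> g r w F, OF \<gamma> g(2) assms(8) w F F_lip this assms(14,16), where k = k]
  obtain x N where x: "\<And>n. \<bar>x n\<bar> \<le> 1" "\<And>n. n \<ge> N \<Longrightarrow> solves_at k r p \<gamma> F x n"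
    by blast
  have "bounded (range x)" using x(1) by (auto simp: bounded_iff)
  from bounded_solution_extend[OF assms(1) _ assms(8,13) this x(2)] \<gamma>(1)
  have "\<exists>x. bounded (range x) \<and> (\<forall>n\<ge>k. solves_at k r p \<gamma> F x n)"
    by (metis less_irrefl)
  then show ?thesis by (simp add: solves_at_def F_def add.assoc)
qed

end
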